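(* The convergence exponent $\lambda^* \colon [0,1] \to [0,1]$ is of Baire class two on $[0,1]$.
   Context: Pierce digits. For $x \in [0,1]$, define $d_1(x) := \lfloor 1/x \rfloor$ and $T(x) := 1 - d_1(x)\,x$ if $x \neq 0$, and $d_1(0) := \infty$, $T(0) := 0$. Here $\lfloor y \rfloor$ is the largest integer not exceeding $y$. For $n \in \mathbb{N} = \{1,2,3,\dots\}$ put $d_n(x) := d_1(T^{n-1}(x))$, where $T^{n-1}$ is the $(n-1)$-fold iterate of $T$ ($T^0$ is the identity). The sequence $(d_n(x))_{n \in \mathbb{N}}$ is the Pierce expansion digit sequence of $x$. Conventions: $\infty^s := \infty$ for $s>0$ and $c/\infty := 0$ for $c \in \mathbb{R}$. Convergence exponent: for $x \in [0,1]$, $\lambda^*(x) := \inf\{ s > 0 : \sum_{n \in \mathbb{N}} 1/(d_n(x))^s \text{ converges} \}$. The function $\lambda^*$ takes values in $[0,1]$. A function $g \colon X \to \mathbb{R}$ on a metrizable space $X$ is of Baire class one (on $X$) if it is the pointwise limit everywhere on $X$ of some sequence of real-valued continuous functions on $X$. It is of Baire class two (on $X$) if it is the pointwise limit everywhere on $X$ of some sequence of functions $(g_n)_{n \in \mathbb{N}}$, each of Baire class one on $X$. The interval $[0,1]$ carries the subspace topology induced by the standard topology of $\mathbb{R}$. *)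

theory Defs
  imports "HOL-Analysis.Analysis"
begin

text \<open>The functions below are total on \<^typ>\<open>real\<close>; only their values on the interval
  \<open>{0..1}\<close> are meaningful. For \<open>0 < x \<le> 1\<close> the floor is a positive integer, so the
  conversion by \<^const>\<open>nat\<close> loses nothing.\<close>

definition pierce_d1 :: "real \<Rightarrow> enat" where
  "pierce_d1 x = (if x = 0 then \<infinity> else enat (nat \<lfloor>1 / x\<rfloor>))"

definition pierce_T :: "real \<Rightarrow> real" where
  "pierce_T x = (if x = 0 then 0 else 1 - of_int \<lfloor>1 / x\<rfloor> * x)"

text \<open>Digits are indexed from 1; the value at index 0 is not used.\<close>

definition pierce_digit :: "nat \<Rightarrow> real \<Rightarrow> enat" where
  "pierce_digit n x = pierce_d1 ((pierce_T ^^ (n - 1)) x)"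

text \<open>The power with the convention \<open>\<infinity>\<^sup>s = \<infinity>\<close>, used only for \<open>s > 0\<close>.\<close>

definition digit_powr :: "enat \<Rightarrow> real \<Rightarrow> ereal" where
  "digit_powr d s = (case d of enat k \<Rightarrow> ereal (real k powr s) | \<infinity> \<Rightarrow> \<infinity>)"

text \<open>The convention \<open>1 / \<infinity> = 0\<close> is that of \<^typ>\<open>ereal\<close>. For \<open>x\<close> in \<open>{0..1}\<close> every
  digit is at least 1, so all quotients are finite and \<^const>\<open>real_of_ereal\<close> loses
  nothing. The shift by \<^const>\<open>Suc\<close> makes the series start at the first digit.\<close>

definition conv_exponent :: "real \<Rightarrow> real" where
  "conv_exponent x =
     Inf {s. s > 0 \<and> summable (\<lambda>n. real_of_ereal (1 / digit_powr (pierce_digit (Suc n) x) s))}"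

definition baire_one_on :: "'a::metric_space set \<Rightarrow> ('a \<Rightarrow> real) \<Rightarrow> bool" where
  "baire_one_on X g \<longleftrightarrow>
     (\<exists>f. (\<forall>n::nat. continuous_on X (f n)) \<and> (\<forall>x\<in>X. (\<lambda>n. f n x) \<longlonglongrightarrow> g x))"

definition baire_two_on :: "'a::metric_space set \<Rightarrow> ('a \<Rightarrow> real) \<Rightarrow> bool" where
  "baire_two_on X g \<longleftrightarrow>
     (\<exists>f. (\<forall>n::nat. baire_one_on X (f n)) \<and> (\<forall>x\<in>X. (\<lambda>n. f n x) \<longlonglongrightarrow> g x))"

end

theory Submission
  imports Defs
begin

text \<open>
  Write \<open>u\<^sub>n(x)\<close> for the reciprocal of the digit with index \<open>n + 1\<close>, and read the convergence
  exponent as a threshold: the series of the \<open>u\<^sub>n(x)\<^sup>s\<close> diverges for \<open>0 < s < \<lambda>\<^sup>*(x)\<close> and converges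
  for \<open>s > \<lambda>\<^sup>*(x)\<close>. The digits of \<open>x\<close> increase strictly as long as they are finite, so \<open>u\<^sub>n(x) \<le> 1 / (n + 1)\<close> and the
  threshold is at most 1.

  The point is that each \<open>u\<^sub>n\<close> is lower semicontinuous, in the strong form that every \<open>x\<close> is a local
  minimum of \<open>u\<^sub>n\<close> (lemma \<open>recip_digit_local_min\<close>). Where \<open>u\<^sub>n(x) = 0\<close> there is nothing to show.
  Otherwise the orbit of \<open>x\<close> has not hit 0 within \<open>n\<close> steps, so it has avoided the discontinuities
  of \<open>T\<close>, and the \<open>n\<close>-th iterate of \<open>T\<close> is continuous at \<open>x\<close>; what is left is the upper
  semicontinuity of the floor.

  Let \<open>g\<^sub>M(x)\<close> be the supremum of 0 and of the exponents \<open>s\<close> in \<open>(0,1)\<close> for which some partial sum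
  of the series exceeds \<open>M\<close>. Exceeding \<open>M\<close> is preserved near \<open>x\<close> because \<open>x\<close> is a local minimum of
  each partial sum, so \<open>g\<^sub>M\<close> is lower semicontinuous, and hence of Baire class one by Baire's
  approximation from below with Lipschitz functions (lemma \<open>baire_one_on_lsc\<close>). As \<open>M\<close> tends to
  infinity, \<open>g\<^sub>M(x)\<close> tends to \<open>\<lambda>\<^sup>*(x)\<close>: divergent exponents are counted for every \<open>M\<close>, and a
  convergent exponent bounds \<open>g\<^sub>M(x)\<close> as soon as \<open>M\<close> exceeds the sum of its series.
\<close>

section \<open>Lower semicontinuous functions are of Baire class one\<close>

text \<open>The function \<open>f\<close> is approximated by its inf-convolutions with \<open>n\<close> times the distance. These
  are \<open>n\<close>-Lipschitz and at most \<open>f\<close>. If \<open>f > a\<close> on the ball of radius \<open>d\<close> about \<open>x\<close>, points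
  outside the ball contribute at least \<open>n d\<close> because \<open>f\<close> is nonnegative, so the approximation at
  \<open>x\<close> is at least \<open>a\<close> once \<open>n d \<ge> a\<close>.\<close>

lemma baire_one_on_lsc:
  fixes f :: "'a::metric_space \<Rightarrow> real"
  assumes nonneg: "\<And>x. x \<in> X \<Longrightarrow> 0 \<le> f x"
    and lsc: "\<And>x a. x \<in> X \<Longrightarrow> a < f x \<Longrightarrow> eventually (\<lambda>y. a < f y) (at x within X)"
  shows "baire_one_on X f"
proof -
  define F where "F n x = (INF y\<in>X. f y + real n * dist x y)" for n :: nat and x
  have bdd: "bdd_below ((\<lambda>y. f y + real n * dist x y) ` X)" for n x
    by (rule bdd_belowI[of _ 0]) (use nonneg in auto)
  have F_le: "F n x \<le> f y + real n * dist x y" if "y \<in> X" for n x y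
    unfolding F_def by (rule cINF_lower[OF bdd that])
  have lip: "F n x \<le> F n z + real n * dist x z" if "x \<in> X" for n x z
  proof -
    have "F n x - real n * dist x z \<le> F n z"
      unfolding F_def[of n z]
    proof (rule cINF_greatest)
      show "X \<noteq> {}" using that by auto
      fix y assume "y \<in> X"
      have "real n * dist x y \<le> real n * dist x z + real n * dist z y"
        by (metis dist_triangle distrib_left mult_left_mono of_nat_0_le_iff)
      with F_le[OF \<open>y \<in> X\<close>, of n x]
      show "F n x - real n * dist x z \<le> f y + real n * dist z y" by linarith
    qed
    then show ?thesis by linarith
  qed
  have "continuous_on X (F n)" for n
  proof (rule lipschitz_on_continuous_on, rule lipschitz_onI)
    fix x z assume "x \<in> X" "z \<in> X"
    then show "dist (F n x) (F n z) \<le> real n * dist x z"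
      using lip[of x n z] lip[of z n x] by (auto simp: dist_real_def dist_commute)
  qed simp
  moreover have "(\<lambda>n. F n x) \<longlonglongrightarrow> f x" if x: "x \<in> X" for x
  proof (rule order_tendstoI)
    fix b assume "f x < b"
    moreover have "F n x \<le> f x" for n using F_le[OF x, of n x] by simp
    ultimately have "F n x < b" for n by (meson order.strict_trans1)
    then show "eventually (\<lambda>n. F n x < b) sequentially" by simp
  next
    fix b assume "b < f x"
    then obtain a where a: "b < a" "a < f x" using dense by blast
    from lsc[OF x a(2)] obtain d where d: "d > 0"
      "\<And>y. y \<in> X \<Longrightarrow> dist y x < d \<Longrightarrow> a < f y"
      unfolding eventually_at using a(2) by metis
    have "eventually (\<lambda>n. a / d \<le> real n) sequentially"
      using filterlim_real_sequentially unfolding filterlim_at_top by blast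
    then show "eventually (\<lambda>n. b < F n x) sequentially"
    proof eventually_elim
      case (elim n)
      have "a \<le> F n x"
        unfolding F_def
      proof (rule cINF_greatest)
        show "X \<noteq> {}" using x by auto
        fix y assume y: "y \<in> X"
        show "a \<le> f y + real n * dist x y"
        proof (cases "dist y x < d")
          case True
          then have "a \<le> f y" using d(2)[OF y] by simp
          then show ?thesis by (simp add: add_increasing2)
        next
          case False
          then have "real n * d \<le> real n * dist x y"
            by (intro mult_left_mono) (auto simp: dist_commute)
          moreover have "a \<le> real n * d" using elim d(1) by (simp add: field_simps)
          ultimately show ?thesis using nonneg[OF y] by linarith
        qed
      qed
      with a(1) show ?case by simp
    qed
  qed
  ultimately show ?thesis unfolding baire_one_on_def by blast
qed

section \<open>Reciprocals of the Pierce digits\<close>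

text \<open>This is \<open>1 / d\<^sub>1(x)\<close> as a real number: the division by \<open>\<lfloor>1 / 0\<rfloor> = 0\<close> yields the value 0
  that the digit \<open>\<infinity>\<close> of the point 0 calls for.\<close>

definition recip_d1 :: "real \<Rightarrow> real" where
  "recip_d1 x = 1 / of_int \<lfloor>1 / x\<rfloor>"

definition recip_digit :: "nat \<Rightarrow> real \<Rightarrow> real" where
  "recip_digit n x = recip_d1 ((pierce_T ^^ n) x)"

lemma pierce_T_0 [simp]: "pierce_T 0 = 0"
  by (simp add: pierce_T_def)

text \<open>One step of \<open>T\<close> raises the first digit: \<open>k = \<lfloor>1 / x\<rfloor> \<ge> m\<close> gives \<open>x > 1 / (k + 1)\<close>, so
  \<open>T x = 1 - k x < 1 / (k + 1)\<close>.\<close>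

lemma pierce_T_bound:
  fixes m :: nat
  assumes "0 \<le> x" "x \<le> 1 / real m" "m > 0"
  shows "0 \<le> pierce_T x \<and> pierce_T x \<le> 1 / real (Suc m)"
proof (cases "x = 0")
  case False
  define k where "k = \<lfloor>1 / x\<rfloor>"
  have x: "x > 0" using False assms by simp
  have "real m \<le> 1 / x" using assms x by (simp add: field_simps)
  then have km: "int m \<le> k" unfolding k_def by (simp add: le_floor_iff)
  have "of_int k \<le> 1 / x" unfolding k_def by simp
  then have 1: "of_int k * x \<le> 1" using x by (simp add: field_simps)
  have "1 / x < of_int k + 1" unfolding k_def by linarith
  then have 2: "1 < (of_int k + 1) * x" using x by (simp add: field_simps)
  have k0: "0 < real_of_int k + 1" using km by linarith
  have "1 / (of_int k + 1) < x" using 2 k0 by (simp add: field_simps)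
  then have "of_int k * (1 / (of_int k + 1)) \<le> of_int k * x"
    using km by (intro mult_left_mono) auto
  moreover have "of_int k * (1 / (of_int k + 1)) = 1 - 1 / (real_of_int k + 1)"
    using k0 by (simp add: field_simps)
  moreover have "1 / (real_of_int k + 1) \<le> 1 / real (Suc m)"
    using km by (intro frac_le) auto
  ultimately show ?thesis
    using 1 False unfolding pierce_T_def k_def[symmetric] by simp
qed simp

lemma funpow_pierce_T_bound:
  assumes "x \<in> {0..1}"
  shows "0 \<le> (pierce_T ^^ n) x \<and> (pierce_T ^^ n) x \<le> 1 / real (Suc n)"
proof (induction n)
  case 0
  show ?case using assms by simp
next
  case (Suc n)
  then show ?case using pierce_T_bound[of "(pierce_T ^^ n) x" "Suc n"] by simp
qed

lemma funpow_pierce_T_range: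
  assumes "x \<in> {0..1}"
  shows "(pierce_T ^^ n) x \<in> {0..1}"
proof -
  have "1 / real (Suc n) \<le> 1" by simp
  then show ?thesis
    using funpow_pierce_T_bound[OF assms, of n] order_trans unfolding atLeastAtMost_iff by blast
qed

lemma recip_digit_bounds:
  assumes "x \<in> {0..1}"
  shows "0 \<le> recip_digit n x" "recip_digit n x \<le> 1 / real (Suc n)"
proof -
  define y where "y = (pierce_T ^^ n) x"
  have y: "0 \<le> y" "y \<le> 1 / real (Suc n)"
    using funpow_pierce_T_bound[OF assms, of n] by (auto simp: y_def)
  show "0 \<le> recip_digit n x"
    unfolding recip_digit_def recip_d1_def y_def[symmetric] using y by simp
  show "recip_digit n x \<le> 1 / real (Suc n)"
  proof (cases "y = 0")
    case True
    then show ?thesis unfolding recip_digit_def recip_d1_def y_def[symmetric] by simp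
  next
    case False
    then have "real (Suc n) \<le> 1 / y" using y by (simp add: field_simps)
    then have "int (Suc n) \<le> \<lfloor>1 / y\<rfloor>" by (simp add: le_floor_iff)
    then have "real (Suc n) \<le> of_int \<lfloor>1 / y\<rfloor>" by linarith
    then show ?thesis unfolding recip_digit_def recip_d1_def y_def[symmetric]
      by (intro frac_le) auto
  qed
qed

lemma recip_digit_le_1: "x \<in> {0..1} \<Longrightarrow> recip_digit n x \<le> 1"
  using recip_digit_bounds(2)[of x n] by (rule order_trans) auto

lemma digit_powr_eq:
  assumes "x \<in> {0..1}" "s > 0"
  shows "real_of_ereal (1 / digit_powr (pierce_digit (Suc n) x) s) = recip_digit n x powr s"
proof -
  define y where "y = (pierce_T ^^ n) x"
  have y: "0 \<le> y" "y \<le> 1"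
    using funpow_pierce_T_range[OF assms(1), of n] by (auto simp: y_def)
  show ?thesis
  proof (cases "y = 0")
    case True
    then show ?thesis
      by (simp add: pierce_digit_def digit_powr_def recip_digit_def recip_d1_def pierce_d1_def
          flip: y_def)
  next
    case False
    then have "1 \<le> 1 / y" using y by (simp add: field_simps)
    then have 1: "1 \<le> \<lfloor>1 / y\<rfloor>" by (simp only: le_floor_iff of_int_1)
    then have "real (nat \<lfloor>1 / y\<rfloor>) = of_int \<lfloor>1 / y\<rfloor>" by (intro of_nat_nat) linarith
    moreover have pos: "0 < real_of_int \<lfloor>1 / y\<rfloor>" using 1 by linarith
    moreover have "real_of_int \<lfloor>1 / y\<rfloor> powr s \<noteq> 0"
      unfolding powr_eq_0_iff using pos by linarith
    moreover have "(1 / real_of_int \<lfloor>1 / y\<rfloor>) powr s = 1 / of_int \<lfloor>1 / y\<rfloor> powr s"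
      using powr_divide[of 1 "of_int \<lfloor>1 / y\<rfloor>" s] pos by simp
    ultimately show ?thesis
      using False
      by (simp add: pierce_digit_def digit_powr_def recip_digit_def recip_d1_def pierce_d1_def
          one_ereal_def del: of_nat_nat flip: y_def)
  qed
qed

section \<open>Lower semicontinuity of the digit reciprocals\<close>

text \<open>The jumps of \<open>T\<close> away from 0 are at the points where \<open>1 / x\<close> is an integer, and \<open>T\<close>
  vanishes there.\<close>

lemma isCont_pierce_T:
  assumes "pierce_T x \<noteq> 0"
  shows "isCont pierce_T x"
proof -
  have x: "x \<noteq> 0" using assms by auto
  have ni: "1 / x \<notin> \<int>"
  proof
    assume "1 / x \<in> \<int>"
    then have "of_int \<lfloor>1 / x\<rfloor> = 1 / x" by (metis Ints_cases floor_of_int)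
    then have "of_int \<lfloor>1 / x\<rfloor> * x = 1" using x by (metis nonzero_eq_divide_eq)
    then show False using assms x by (simp add: pierce_T_def)
  qed
  have "isCont (\<lambda>y. 1 / y) x" using x by (intro continuous_intros)
  then have "((\<lambda>y. 1 / y) \<longlongrightarrow> 1 / x) (at x)" by (simp add: isCont_def)
  then have "eventually (\<lambda>y. \<lfloor>1 / y\<rfloor> = \<lfloor>1 / x\<rfloor>) (at x)"
    by (rule eventually_floor_eq[OF _ ni])
  moreover have "eventually (\<lambda>y. y \<noteq> 0) (at x)"
    by (rule tendsto_imp_eventually_ne[OF tendsto_ident_at x])
  ultimately have "eventually (\<lambda>y. 1 - of_int \<lfloor>1 / x\<rfloor> * y = pierce_T y) (at x)"
    by eventually_elim (simp add: pierce_T_def)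
  moreover have "((\<lambda>y. 1 - of_int \<lfloor>1 / x\<rfloor> * y) \<longlongrightarrow> 1 - of_int \<lfloor>1 / x\<rfloor> * x) (at x)"
    by (intro tendsto_intros)
  ultimately have "(pierce_T \<longlongrightarrow> 1 - of_int \<lfloor>1 / x\<rfloor> * x) (at x)"
    by (rule Lim_transform_eventually[rotated])
  then show ?thesis using x by (simp add: isCont_def pierce_T_def)
qed

text \<open>Since \<open>T 0 = 0\<close>, an orbit that is not at 0 after \<open>n\<close> steps has not met 0 earlier.\<close>

lemma isCont_funpow_pierce_T:
  assumes "(pierce_T ^^ n) x \<noteq> 0"
  shows "isCont (pierce_T ^^ n) x"
  using assms
proof (induction n)
  case (Suc n)
  then have nz: "pierce_T ((pierce_T ^^ n) x) \<noteq> 0" by simp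
  then have "(pierce_T ^^ n) x \<noteq> 0" by force
  then have "isCont pierce_T ((pierce_T ^^ n) x)" "isCont (pierce_T ^^ n) x"
    using isCont_pierce_T[OF nz] Suc.IH by blast+
  then have "isCont (pierce_T \<circ> (pierce_T ^^ n)) x" by (intro continuous_at_compose)
  then show ?case by (simp add: comp_def)
qed (simp add: id_def)

text \<open>Close to a point with a finite digit \<open>d\<close>, the integer-valued digit can only stay or drop,
  because the floor is upper semicontinuous.\<close>

lemma recip_digit_local_min:
  assumes x: "x \<in> {0..1}"
  shows "eventually (\<lambda>y. recip_digit n x \<le> recip_digit n y) (at x within {0..1})"
proof (cases "(pierce_T ^^ n) x = 0")
  case True
  then have 0: "recip_digit n x = 0" by (simp add: recip_digit_def recip_d1_def)
  show ?thesis
    unfolding eventually_at_filter 0 by (rule always_eventually) (auto intro: recip_digit_bounds)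
next
  case False
  let ?T = "pierce_T ^^ n"
  have pos: "?T x > 0" using funpow_pierce_T_bound[OF x, of n] False by simp
  have "isCont ?T x" by (rule isCont_funpow_pierce_T[OF False])
  then have lim: "(?T \<longlongrightarrow> ?T x) (at x within {0..1})"
    unfolding isCont_def by (rule Lim_at_imp_Lim_at_within)
  have "((\<lambda>y. 1 / ?T y) \<longlongrightarrow> 1 / ?T x) (at x within {0..1})"
    by (intro tendsto_intros lim False)
  moreover have "1 / ?T x < of_int \<lfloor>1 / ?T x\<rfloor> + 1" by linarith
  ultimately have "eventually (\<lambda>y. 1 / ?T y < of_int \<lfloor>1 / ?T x\<rfloor> + 1) (at x within {0..1})"
    by (rule order_tendstoD)
  moreover have "eventually (\<lambda>y. 0 < ?T y) (at x within {0..1})"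
    by (rule order_tendstoD(1)[OF lim pos])
  moreover have "eventually (\<lambda>y. y \<in> {0..1}) (at x within {0..1})"
    by (simp add: eventually_at_filter)
  ultimately show ?thesis
  proof eventually_elim
    case (elim y)
    have "?T y \<le> 1" using funpow_pierce_T_range[OF elim(3), of n] by simp
    then have "1 \<le> 1 / ?T y" using elim by (simp add: field_simps)
    then have 1: "1 \<le> \<lfloor>1 / ?T y\<rfloor>" by (simp add: le_floor_iff)
    have "\<lfloor>1 / ?T y\<rfloor> \<le> \<lfloor>1 / ?T x\<rfloor>" using elim(1) by linarith
    then show ?case
      unfolding recip_digit_def recip_d1_def using 1 by (intro frac_le) auto
  qed
qed

section \<open>The convergence exponent as a threshold\<close>

lemma conv_exponent_eq:
  assumes "x \<in> {0..1}"
  shows "conv_exponent x = Inf {s. s > 0 \<and> summable (\<lambda>n. recip_digit n x powr s)}"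
  unfolding conv_exponent_def using digit_powr_eq[OF assms] by (intro arg_cong[where f = Inf]) auto

lemma summable_recip_digit_powr_mono:
  assumes "x \<in> {0..1}" "s \<le> t" "summable (\<lambda>n. recip_digit n x powr s)"
  shows "summable (\<lambda>n. recip_digit n x powr t)"
  using assms(3)
  by (rule summable_comparison_test')
    (use assms recip_digit_bounds(1) recip_digit_le_1 in \<open>auto intro!: powr_mono'\<close>)

lemma summable_recip_digit_powr_gt_1:
  assumes x: "x \<in> {0..1}" and s: "s > 1"
  shows "summable (\<lambda>n. recip_digit n x powr s)"
proof -
  have "summable (\<lambda>n. real n powr -s)" using s by (simp add: summable_real_powr_iff)
  then have "summable (\<lambda>n. real (Suc n) powr -s)" by (subst summable_Suc_iff)
  then show ?thesis
  proof (rule summable_comparison_test')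
    fix n
    have "recip_digit n x powr s \<le> (1 / real (Suc n)) powr s"
      using recip_digit_bounds[OF x, of n] s by (intro powr_mono2) auto
    also have "\<dots> = real (Suc n) powr -s" by (simp add: powr_divide powr_minus_divide)
    finally show "norm (recip_digit n x powr s) \<le> real (Suc n) powr -s" by simp
  qed
qed

lemma summable_above_conv_exponent:
  assumes x: "x \<in> {0..1}" and s: "conv_exponent x < s"
  shows "summable (\<lambda>n. recip_digit n x powr s)"
proof -
  let ?E = "{s. s > 0 \<and> summable (\<lambda>n. recip_digit n x powr s)}"
  have "2 \<in> ?E" using summable_recip_digit_powr_gt_1[OF x, of 2] by simp
  then have "?E \<noteq> {}" by (metis empty_iff)
  then have "\<exists>t\<in>?E. t < s" using s unfolding conv_exponent_eq[OF x] by (rule cInf_lessD)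
  then obtain t where "t < s" "summable (\<lambda>n. recip_digit n x powr t)" by auto
  then show ?thesis using summable_recip_digit_powr_mono[OF x, of t s] by simp
qed

lemma conv_exponent_le:
  assumes x: "x \<in> {0..1}" and "s > 0" "summable (\<lambda>n. recip_digit n x powr s)"
  shows "conv_exponent x \<le> s"
  unfolding conv_exponent_eq[OF x] using assms
  by (intro cInf_lower) (auto intro!: bdd_belowI[of _ 0])

lemma conv_exponent_in_unit_interval:
  assumes x: "x \<in> {0..1}"
  shows "conv_exponent x \<in> {0..1}"
proof -
  have "0 \<le> conv_exponent x"
    unfolding conv_exponent_eq[OF x]
    using summable_recip_digit_powr_gt_1[OF x, of 2] by (intro cInf_greatest) force+
  moreover have "conv_exponent x \<le> 1"
    by (rule dense_ge) (use conv_exponent_le[OF x] summable_recip_digit_powr_gt_1[OF x] in auto)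
  ultimately show ?thesis by simp
qed

section \<open>Approximation by lower semicontinuous functions\<close>

definition big_exponents :: "nat \<Rightarrow> real \<Rightarrow> real set" where
  "big_exponents M x = {s. 0 < s \<and> s < 1 \<and> (\<exists>N. real M < (\<Sum>n<N. recip_digit n x powr s))}"

text \<open>The element 0 is inserted because the real supremum of the empty set is unspecified.\<close>

definition approx_exponent :: "nat \<Rightarrow> real \<Rightarrow> real" where
  "approx_exponent M x = Sup (insert 0 (big_exponents M x))"

lemma bdd_above_big_exponents: "bdd_above (insert 0 (big_exponents M x))"
  by (rule bdd_aboveI[of _ 1]) (auto simp: big_exponents_def)

lemma approx_exponent_ge: "s \<in> insert 0 (big_exponents M x) \<Longrightarrow> s \<le> approx_exponent M x"
  unfolding approx_exponent_def by (intro cSup_upper bdd_above_big_exponents)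

text \<open>A large exponent \<open>s\<close> of \<open>x\<close> is one of every \<open>y\<close> near \<open>x\<close>: the witnessing partial sum involves
  finitely many digits, each of which has a local minimum of its reciprocal at \<open>x\<close>.\<close>

lemma baire_one_on_approx_exponent: "baire_one_on {0..1} (approx_exponent M)"
proof (rule baire_one_on_lsc)
  show "0 \<le> approx_exponent M x" for x by (rule approx_exponent_ge) simp
next
  fix x a :: real
  assume x: "x \<in> {0..1}" and "a < approx_exponent M x"
  then obtain s where s: "s \<in> insert 0 (big_exponents M x)" "a < s"
    unfolding approx_exponent_def using less_cSupD[of "insert 0 (big_exponents M x)" a] by auto
  have "eventually (\<lambda>y. s \<in> insert 0 (big_exponents M y)) (at x within {0..1})"
  proof (cases "s = 0")
    case False
    then obtain N where N: "0 < s" "s < 1" "real M < (\<Sum>n<N. recip_digit n x powr s)"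
      using s(1) by (auto simp: big_exponents_def)
    have "eventually (\<lambda>y. \<forall>n\<in>{..<N}. recip_digit n x \<le> recip_digit n y) (at x within {0..1})"
      by (simp add: eventually_ball_finite recip_digit_local_min[OF x])
    then show ?thesis
    proof eventually_elim
      case (elim y)
      then have "(\<Sum>n<N. recip_digit n x powr s) \<le> (\<Sum>n<N. recip_digit n y powr s)"
        using N recip_digit_bounds(1)[OF x] by (intro sum_mono powr_mono2) auto
      with N(3) have "real M < (\<Sum>n<N. recip_digit n y powr s)" by linarith
      with N(1,2) show ?case unfolding big_exponents_def by blast
    qed
  qed simp
  then show "eventually (\<lambda>y. a < approx_exponent M y) (at x within {0..1})"
    by eventually_elim (rule order.strict_trans2[OF s(2) approx_exponent_ge])
qed

lemma approx_exponent_tendsto: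
  assumes x: "x \<in> {0..1}"
  shows "(\<lambda>M. approx_exponent M x) \<longlonglongrightarrow> conv_exponent x"
proof (rule order_tendstoI)
  fix a assume a: "a < conv_exponent x"
  have "a < approx_exponent M x" for M
  proof (cases "a < 0")
    case True
    then show ?thesis using approx_exponent_ge[of 0 M x] by simp
  next
    case False
    obtain s where s: "a < s" "s < conv_exponent x" using a dense by blast
    then have s01: "0 < s" "s < 1" using False conv_exponent_in_unit_interval[OF x] by auto
    have "\<exists>N. real M < (\<Sum>n<N. recip_digit n x powr s)"
    proof (rule ccontr)
      assume "\<not> ?thesis"
      then have "summable (\<lambda>n. recip_digit n x powr s)"
        by (intro summableI_nonneg_bounded[where x = "real M"]) (auto simp: not_less)
      then show False using conv_exponent_le[OF x s01(1)] s(2) by simp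
    qed
    then have "s \<in> big_exponents M x" using s01 by (simp add: big_exponents_def)
    then show ?thesis using s(1) approx_exponent_ge[of s M x] by simp
  qed
  then show "eventually (\<lambda>M. a < approx_exponent M x) sequentially" by simp
next
  fix a assume "conv_exponent x < a"
  then obtain t where t: "conv_exponent x < t" "t < a" using dense by blast
  have t0: "0 < t" using t(1) conv_exponent_in_unit_interval[OF x] by auto
  let ?S = "\<lambda>s. \<Sum>n. recip_digit n x powr s"
  have "eventually (\<lambda>M. ?S t \<le> real M) sequentially"
    using filterlim_real_sequentially unfolding filterlim_at_top by blast
  then show "eventually (\<lambda>M. approx_exponent M x < a) sequentially"
  proof eventually_elim
    case (elim M)
    have "s \<le> t" if s: "s \<in> big_exponents M x" for s
    proof (rule ccontr)
      assume "\<not> s \<le> t"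
      obtain N where "real M < (\<Sum>n<N. recip_digit n x powr s)"
        using s by (auto simp: big_exponents_def)
      also have "\<dots> \<le> (\<Sum>n<N. recip_digit n x powr t)"
        using \<open>\<not> s \<le> t\<close> recip_digit_bounds(1)[OF x] recip_digit_le_1[OF x]
        by (intro sum_mono powr_mono') auto
      also have "\<dots> \<le> ?S t"
        by (intro sum_le_suminf summable_above_conv_exponent[OF x t(1)]) auto
      finally show False using elim by simp
    qed
    then have "approx_exponent M x \<le> t"
      unfolding approx_exponent_def using t0 by (intro cSup_least) auto
    with t(2) show ?case by simp
  qed
qed

theorem theorem1p6:
  shows "conv_exponent \<in> {0..1} \<rightarrow> {0..1} \<and> baire_two_on {0..1} conv_exponent"
proof
  show "conv_exponent \<in> {0..1} \<rightarrow> {0..1}" using conv_exponent_in_unit_interval by blast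
  show "baire_two_on {0..1} conv_exponent"
    unfolding baire_two_on_def
    using baire_one_on_approx_exponent approx_exponent_tendsto by blast
qed

end
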